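(* Let $\mathcal{H}$ be a real Hilbert space, let $M$ be a nonempty closed and affine subset of $\mathcal{H}$ and let $T:M\rightarrow M$ be a nonexpansive operator such that $\operatorname{Fix} T\neq\varnothing$. Consider the iterative scheme $$x_{n+1}=x_n+\alpha_n(x_n-x_{n-1})+\lambda_n\Big[T\big(x_n+\alpha_n(x_n-x_{n-1})\big)-x_n-\alpha_n(x_n-x_{n-1})\Big]\quad \forall n\geq 1,$$ where $x_0,x_1$ are arbitrarily chosen in $M$, $(\alpha_n)_{n\geq 1}$ is a nondecreasing sequence of real numbers with $\alpha_1=0$ and $0\leq \alpha_n\leq\alpha<1$ for every $n\geq 1$ (with $\alpha$ a real number), and $\lambda,\sigma,\delta>0$ and the real sequence $(\lambda_n)_{n\geq 1}$ are such that $$\delta>\frac{\alpha^2(1+\alpha)+\alpha\sigma}{1-\alpha^2}\quad\text{and}\quad 0<\lambda\leq\lambda_n\leq \frac{\delta-\alpha\big[\alpha(1+\alpha)+\alpha\delta+\sigma\big]}{\delta\big[1+\alpha(1+\alpha)+\alpha\delta+\sigma\big]}\quad \forall n\geq 1.$$ Then the following statements are true: (i) $\sum_{n\in\mathbb{N}}\|x_{n+1}-x_n\|^2<+\infty$; (ii) $(x_n)_{n\in\mathbb{N}}$ converges weakly to a point in $\operatorname{Fix} T$.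
   Context: $\mathbb{N}=\{0,1,2,\ldots\}$. An operator $T:D\to\mathcal{H}$ with $D\subseteq\mathcal{H}$ nonempty is nonexpansive if $\|Tx-Ty\|\leq\|x-y\|$ for all $x,y\in D$; $\operatorname{Fix}T=\{x\in D: Tx=x\}$ denotes its set of fixed points. *)

theory Defs
  imports "HOL-Analysis.Analysis"
begin

(* An operator T : D -> H is a total function on the ambient space; the definitions
   below only refer to its values on D. *)

definition nonexpansive_on :: "'a::real_normed_vector set \<Rightarrow> ('a \<Rightarrow> 'a) \<Rightarrow> bool" where
  "nonexpansive_on D T \<longleftrightarrow> (\<forall>x\<in>D. \<forall>y\<in>D. norm (T x - T y) \<le> norm (x - y))"

definition Fix_on :: "'a set \<Rightarrow> ('a \<Rightarrow> 'a) \<Rightarrow> 'a set" where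
  "Fix_on D T = {x \<in> D. T x = x}"

(* Convergence in the weak topology of an inner product space, i.e. the coarsest topology
   making every functional y \<mapsto> y \<bullet> u continuous. *)
definition weakly_converges_to :: "(nat \<Rightarrow> 'a::real_inner) \<Rightarrow> 'a \<Rightarrow> bool" where
  "weakly_converges_to x l \<longleftrightarrow> (\<forall>u. (\<lambda>n. x n \<bullet> u) \<longlonglongrightarrow> l \<bullet> u)"

end

theory Submission
  imports Defs
begin

text \<open>
  Two independent ideas carry the proof.

  \<^emph>\<open>An energy that decreases.\<close> Write \<open>\<phi>\<^sub>n\<close> for the squared distance of the \<open>n\<close>-th iterate to a fixed
  point \<open>p\<close> and \<open>d\<^sub>n\<close> for the \<open>n\<close>-th increment. Inertia can make \<open>\<phi>\<close> non-monotone, but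
  \<open>\<phi>\<^sub>n - \<alpha>\<^sub>n \<phi>\<^sub>n\<^sub>-\<^sub>1\<close> plus a multiple of \<open>\<parallel>d\<^sub>n\<parallel>\<^sup>2\<close> decreases by at least
  \<open>\<sigma> \<parallel>d\<^sub>n\<^sub>+\<^sub>1\<parallel>\<^sup>2\<close> in each step (\<open>energy_decrease\<close>). The upper bound on the relaxation parameters is
  tailored to this inequality, which follows from the step inequality
  \<open>distance_recursion\<close>, where the cross term between two consecutive increments is split by
  Young's inequality with weight \<open>\<alpha>\<^sub>n + \<delta> \<lambda>\<^sub>n\<close>. The energy controls
  \<open>\<phi>\<^sub>n - \<alpha> \<phi>\<^sub>n\<^sub>-\<^sub>1\<close> from above, so with \<open>\<alpha> < 1\<close> the \<open>\<phi>\<^sub>n\<close> are bounded; then the energy is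
  bounded below, and telescoping gives the summability of the squared increments. Moreover the
  energy converges and its increment term vanishes, so \<open>\<phi>\<^sub>n - \<alpha>\<^sub>n \<phi>\<^sub>n\<^sub>-\<^sub>1\<close> converges; as \<open>\<alpha>\<^sub>n\<close> has a
  limit below \<open>1\<close>, the sequence \<open>\<phi>\<close> itself converges (\<open>convergent_distance\<close>). Vanishing
  increments together with the lower bound on the relaxation parameters force
  \<open>x\<^sub>n - T x\<^sub>n \<longlonglongrightarrow> 0\<close> (\<open>asymptotically_regular\<close>).

  \<^emph>\<open>Asymptotic centers in place of weak compactness.\<close> The asymptotic radius of a bounded sequence
  at \<open>y\<close> is the limit superior of \<open>\<parallel>x\<^sub>n - y\<parallel>\<close>. By the parallelogram law it has exactly one
  minimizer, the asymptotic center, which lies in every closed convex set containing the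
  sequence. If \<open>x\<^sub>n - T x\<^sub>n \<longlonglongrightarrow> 0\<close> then \<open>T\<close> does not increase the asymptotic radius, so the
  center is a fixed point; this plays the part of demiclosedness and applies to every subsequence.
  Since the distances to each fixed point converge, all subsequences have the same radius at
  fixed points, so the center of the whole sequence minimizes the radius of every subsequence.
  If \<open>x\<^sub>n\<close> did not converge weakly to it, then moving it slightly in a direction that witnesses
  the failure would lower the radius of some subsequence
  (\<open>weakly_converges_to_asymptotic_center\<close>, a variant of Opial's lemma).
\<close>

section \<open>Asymptotic centers\<close>

text \<open>
  For a bounded sequence this is the limit superior of the distances to \<open>y\<close>. The infimum of
  eventual bounds keeps it real-valued.
\<close>
definition asymptotic_radius :: "(nat \<Rightarrow> 'a::real_normed_vector) \<Rightarrow> 'a \<Rightarrow> real" where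
  "asymptotic_radius x y = Inf {r. \<forall>\<^sub>F n in sequentially. norm (x n - y) \<le> r}"

lemma eventual_norm_bound_nonneg:
  assumes "\<forall>\<^sub>F n in sequentially. norm (x n - y) \<le> r"
  shows "r \<ge> 0"
proof -
  obtain n where "norm (x n - y) \<le> r"
    using assms eventually_happens' sequentially_bot by blast
  then show ?thesis
    by (rule order_trans[OF norm_ge_zero])
qed

lemma asymptotic_radius_le:
  assumes "\<forall>\<^sub>F n in sequentially. norm (x n - y) \<le> r"
  shows "asymptotic_radius x y \<le> r"
  unfolding asymptotic_radius_def
  using assms by (intro cInf_lower bdd_belowI[of _ 0]) (auto dest: eventual_norm_bound_nonneg)

lemma bounded_eventual_norm_bound:
  assumes "bounded (range x)"
  shows "\<exists>r. \<forall>\<^sub>F n in sequentially. norm (x n - y) \<le> r"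
proof -
  obtain B where "\<And>n. norm (x n) \<le> B"
    using assms by (auto simp: bounded_iff)
  then have "norm (x n - y) \<le> B + norm y" for n
    by (meson add_mono norm_triangle_ineq4 order_refl order_trans)
  then show ?thesis
    by (auto intro!: exI[of _ "B + norm y"])
qed

lemma asymptotic_radius_nonneg:
  assumes "bounded (range x)"
  shows "asymptotic_radius x y \<ge> 0"
  unfolding asymptotic_radius_def
  using bounded_eventual_norm_bound[OF assms]
  by (intro cInf_greatest) (auto dest: eventual_norm_bound_nonneg)

lemma asymptotic_radius_less_imp:
  assumes "bounded (range x)" and "asymptotic_radius x y < r"
  shows "\<forall>\<^sub>F n in sequentially. norm (x n - y) \<le> r"
proof -
  obtain s where "\<forall>\<^sub>F n in sequentially. norm (x n - y) \<le> s" "s < r"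
    using cInf_lessD[of "{r. \<forall>\<^sub>F n in sequentially. norm (x n - y) \<le> r}" r]
      bounded_eventual_norm_bound[OF assms(1), of y] assms(2)
    unfolding asymptotic_radius_def by blast
  then show ?thesis
    by (auto elim: eventually_mono)
qed

lemma asymptotic_radius_power2_le:
  assumes "bounded (range x)"
    and "\<forall>\<^sub>F n in sequentially. (norm (x n - y))\<^sup>2 \<le> q"
  shows "(asymptotic_radius x y)\<^sup>2 \<le> q"
proof -
  have *: "\<forall>\<^sub>F n in sequentially. norm (x n - y) \<le> sqrt q"
    using assms(2) by eventually_elim (rule real_le_rsqrt)
  then have "0 \<le> sqrt q" "asymptotic_radius x y \<le> sqrt q"
    by (rule eventual_norm_bound_nonneg, rule asymptotic_radius_le)
  then show ?thesis
    using asymptotic_radius_nonneg[OF assms(1), of y]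
    by (metis power_mono real_sqrt_ge_0_iff real_sqrt_pow2)
qed

lemma asymptotic_radius_eq_lim:
  assumes "(\<lambda>n. norm (x n - y)) \<longlonglongrightarrow> l" and "bounded (range x)"
  shows "asymptotic_radius x y = l"
proof (rule antisym)
  show "asymptotic_radius x y \<le> l"
  proof (rule field_le_epsilon)
    fix e :: real assume "e > 0"
    then have "\<forall>\<^sub>F n in sequentially. norm (x n - y) < l + e"
      by (intro order_tendstoD(2)[OF assms(1)]) simp
    then show "asymptotic_radius x y \<le> l + e"
      by (intro asymptotic_radius_le) (auto elim: eventually_mono)
  qed
  show "l \<le> asymptotic_radius x y"
  proof (rule field_le_epsilon)
    fix e :: real assume "e > 0"
    then have "\<forall>\<^sub>F n in sequentially. norm (x n - y) \<le> asymptotic_radius x y + e"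
      by (intro asymptotic_radius_less_imp[OF assms(2)]) simp
    then show "l \<le> asymptotic_radius x y + e"
      by (intro tendsto_upperbound[OF assms(1)]) auto
  qed
qed

lemma asymptotic_radius_le_add_norm:
  assumes "bounded (range x)"
  shows "asymptotic_radius x z \<le> asymptotic_radius x y + norm (y - z)"
proof (rule field_le_epsilon)
  fix e :: real assume "e > 0"
  then have "\<forall>\<^sub>F n in sequentially. norm (x n - y) \<le> asymptotic_radius x y + e"
    by (intro asymptotic_radius_less_imp[OF assms]) simp
  then have "\<forall>\<^sub>F n in sequentially. norm (x n - z) \<le> asymptotic_radius x y + norm (y - z) + e"
  proof eventually_elim
    case (elim n)
    have "norm (x n - z) \<le> norm (x n - y) + norm (y - z)"
      using norm_triangle_ineq[of "x n - y" "y - z"] by simp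
    with elim show ?case by simp
  qed
  then show "asymptotic_radius x z \<le> asymptotic_radius x y + norm (y - z) + e"
    by (rule asymptotic_radius_le)
qed

lemma parallelogram_law_power2:
  fixes a b :: "'a::real_inner"
  shows "(norm (a + b))\<^sup>2 + (norm (a - b))\<^sup>2 = 2 * (norm a)\<^sup>2 + 2 * (norm b)\<^sup>2"
  unfolding power2_norm_eq_inner by (simp add: inner_add inner_diff)

lemma norm_power2_midpoint:
  fixes u y z :: "'a::real_inner"
  shows "(norm (u - midpoint y z))\<^sup>2
    = ((norm (u - y))\<^sup>2 + (norm (u - z))\<^sup>2) / 2 - (norm (y - z))\<^sup>2 / 4"
proof -
  have "u - midpoint y z = (1 / 2) *\<^sub>R ((u - y) + (u - z))"
    by (simp add: midpoint_def algebra_simps flip: scaleR_add_left)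
  then have "(norm (u - midpoint y z))\<^sup>2 = (norm ((u - y) + (u - z)))\<^sup>2 / 4"
    by (simp add: power_divide)
  moreover have "(norm (y - z))\<^sup>2 = (norm ((u - y) - (u - z)))\<^sup>2"
    by (simp add: norm_minus_commute)
  moreover have "(norm ((u - y) + (u - z)))\<^sup>2 + (norm ((u - y) - (u - z)))\<^sup>2
      = 2 * (norm (u - y))\<^sup>2 + 2 * (norm (u - z))\<^sup>2"
    by (rule parallelogram_law_power2)
  ultimately show ?thesis by (simp add: field_simps)
qed

text \<open>
  The parallelogram law makes the squared radius strongly convex: two points at which the radius
  is at most \<open>s\<close> cannot be far apart when \<open>s\<close> is close to the radius at their midpoint. This one
  estimate gives both existence and uniqueness of minimizers.
\<close>
lemma asymptotic_radius_midpoint: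
  fixes x :: "nat \<Rightarrow> 'a::real_inner"
  assumes b: "bounded (range x)"
    and y: "asymptotic_radius x y \<le> s" and z: "asymptotic_radius x z \<le> s"
  shows "(asymptotic_radius x (midpoint y z))\<^sup>2 \<le> s\<^sup>2 - (norm (y - z))\<^sup>2 / 4"
proof -
  have "s \<ge> 0"
    using asymptotic_radius_nonneg[OF b, of y] y by simp
  have le: "(asymptotic_radius x (midpoint y z))\<^sup>2 \<le> t\<^sup>2 - (norm (y - z))\<^sup>2 / 4" if "t > s" for t
  proof (rule asymptotic_radius_power2_le[OF b])
    have "\<forall>\<^sub>F n in sequentially. norm (x n - y) \<le> t" "\<forall>\<^sub>F n in sequentially. norm (x n - z) \<le> t"
      using y z that by (auto intro!: asymptotic_radius_less_imp[OF b])
    then show "\<forall>\<^sub>F n in sequentially. (norm (x n - midpoint y z))\<^sup>2 \<le> t\<^sup>2 - (norm (y - z))\<^sup>2 / 4"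
    proof eventually_elim
      case (elim n)
      then have "(norm (x n - y))\<^sup>2 \<le> t\<^sup>2" "(norm (x n - z))\<^sup>2 \<le> t\<^sup>2"
        by (auto intro: power_mono)
      then show ?case by (simp add: norm_power2_midpoint)
    qed
  qed
  have "((\<lambda>t. t\<^sup>2 - (norm (y - z))\<^sup>2 / 4) \<longlongrightarrow> s\<^sup>2 - (norm (y - z))\<^sup>2 / 4) (at_right s)"
    by (intro tendsto_intros)
  then show ?thesis
    by (rule tendsto_lowerbound)
      (auto simp: le intro: eventually_mono[OF eventually_at_right_less])
qed

text \<open>
  A minimizing sequence is Cauchy by the midpoint estimate: midpoints stay in the convex set, so
  their radius is at least the infimum \<open>m\<close>.
\<close>
lemma asymptotic_center_exists:
  fixes x :: "nat \<Rightarrow> 'a::{real_inner, complete_space}"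
  assumes b: "bounded (range x)" and C: "closed C" "convex C" "C \<noteq> {}"
  obtains c where "c \<in> C" "\<And>y. y \<in> C \<Longrightarrow> asymptotic_radius x c \<le> asymptotic_radius x y"
proof -
  let ?R = "asymptotic_radius x"
  define m where "m = Inf (?R ` C)"
  have bdd: "bdd_below (?R ` C)"
    using asymptotic_radius_nonneg[OF b] by (auto intro: bdd_belowI[of _ 0])
  have m_le: "m \<le> ?R y" if "y \<in> C" for y
    unfolding m_def using that bdd by (auto intro: cInf_lower)
  have "m \<ge> 0"
    unfolding m_def using C asymptotic_radius_nonneg[OF b] by (auto intro: cInf_greatest)
  have "\<exists>y\<in>C. ?R y < m + inverse (real (Suc k))" for k
    using cInf_lessD[of "?R ` C" "m + inverse (real (Suc k))"] C(3) by (auto simp: m_def)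
  then obtain w where w: "\<And>k. w k \<in> C" "\<And>k. ?R (w k) < m + inverse (real (Suc k))"
    by metis
  \<comment> \<open>Terms beyond \<open>N\<close> have radius at most \<open>s = m + 1 / (N + 1)\<close> and their midpoint has radius at
    least \<open>m\<close>, so \<open>asymptotic_radius_midpoint\<close> bounds their distance.\<close>
  have close: "(norm (w i - w j))\<^sup>2 \<le> 4 * ((m + inverse (real (Suc N)))\<^sup>2 - m\<^sup>2)"
    if "i \<ge> N" "j \<ge> N" for i j N
  proof -
    have R: "?R (w k) \<le> m + inverse (real (Suc N))" if "k \<ge> N" for k
    proof -
      have "inverse (real (Suc k)) \<le> inverse (real (Suc N))"
        using that by (intro le_imp_inverse_le) auto
      then show ?thesis using w(2)[of k] by linarith
    qed
    have "midpoint (w i) (w j) \<in> C"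
      using convexD[OF C(2) w(1)[of i] w(1)[of j], of "1/2" "1/2"]
      by (simp add: midpoint_def scaleR_add_right)
    then have "m\<^sup>2 \<le> (?R (midpoint (w i) (w j)))\<^sup>2"
      using m_le \<open>m \<ge> 0\<close> by (intro power_mono) auto
    also have "\<dots> \<le> (m + inverse (real (Suc N)))\<^sup>2 - (norm (w i - w j))\<^sup>2 / 4"
      using R that by (intro asymptotic_radius_midpoint[OF b]) auto
    finally show ?thesis by simp
  qed
  have "(\<lambda>N. 4 * ((m + inverse (real (Suc N)))\<^sup>2 - m\<^sup>2)) \<longlonglongrightarrow> 4 * ((m + 0)\<^sup>2 - m\<^sup>2)"
    by (intro tendsto_intros LIMSEQ_inverse_real_of_nat)
  then have small: "(\<lambda>N. 4 * ((m + inverse (real (Suc N)))\<^sup>2 - m\<^sup>2)) \<longlonglongrightarrow> 0"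
    by simp
  have "Cauchy w"
  proof (rule CauchyI)
    fix e :: real assume "e > 0"
    then have "\<forall>\<^sub>F N in sequentially. 4 * ((m + inverse (real (Suc N)))\<^sup>2 - m\<^sup>2) < e\<^sup>2"
      by (intro order_tendstoD(2)[OF small]) simp
    then obtain N where N: "4 * ((m + inverse (real (Suc N)))\<^sup>2 - m\<^sup>2) < e\<^sup>2"
      using eventually_happens' sequentially_bot by blast
    have "norm (w i - w j) < e" if "i \<ge> N" "j \<ge> N" for i j
      using close[OF that] N \<open>e > 0\<close> by (intro power2_less_imp_less[of _ e]) auto
    then show "\<exists>N. \<forall>i\<ge>N. \<forall>j\<ge>N. norm (w i - w j) < e" by blast
  qed
  then obtain c where c: "w \<longlonglongrightarrow> c"
    by (auto simp: Cauchy_convergent_iff convergent_def)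
  have "c \<in> C"
    using closed_sequentially[OF C(1) _ c] w(1) by blast
  have "(\<lambda>k. m + inverse (real (Suc k)) + norm (w k - c)) \<longlonglongrightarrow> m + 0 + norm (c - c)"
    by (intro tendsto_intros LIMSEQ_inverse_real_of_nat c)
  then have "?R c \<le> m + 0 + norm (c - c)"
  proof (rule tendsto_lowerbound)
    show "\<forall>\<^sub>F k in sequentially. ?R c \<le> m + inverse (real (Suc k)) + norm (w k - c)"
      using asymptotic_radius_le_add_norm[OF b, of c] w(2)
      by (intro always_eventually allI) (smt (verit))
  qed simp
  then show thesis
    using m_le \<open>c \<in> C\<close> by (intro that[of c]) force+
qed

lemma asymptotic_center_unique:
  fixes x :: "nat \<Rightarrow> 'a::real_inner"
  assumes b: "bounded (range x)"
    and min: "\<And>y. asymptotic_radius x c \<le> asymptotic_radius x y"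
    and le: "asymptotic_radius x z \<le> asymptotic_radius x c"
  shows "z = c"
proof -
  have "(asymptotic_radius x c)\<^sup>2 \<le> (asymptotic_radius x (midpoint z c))\<^sup>2"
    using min asymptotic_radius_nonneg[OF b] by (intro power_mono) auto
  also have "\<dots> \<le> (asymptotic_radius x c)\<^sup>2 - (norm (z - c))\<^sup>2 / 4"
    using le by (intro asymptotic_radius_midpoint[OF b]) auto
  finally show ?thesis by simp
qed

text \<open>
  The asymptotic center of a constant sequence, taken within \<open>C\<close>, is the metric projection onto
  \<open>C\<close>. Projecting does not increase the distance to any point of \<open>C\<close>.
\<close>
lemma closed_convex_projection:
  fixes C :: "'a::{real_inner, complete_space} set"
  assumes C: "closed C" "convex C" "C \<noteq> {}"
  obtains q where "q \<in> C" "\<And>y. y \<in> C \<Longrightarrow> norm (y - q) \<le> norm (y - a)"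
proof -
  have b: "bounded (range (\<lambda>n::nat. a))" by simp
  have R: "asymptotic_radius (\<lambda>n. a) y = norm (a - y)" for y
    by (rule asymptotic_radius_eq_lim) auto
  obtain q where q: "q \<in> C" "\<And>y. y \<in> C \<Longrightarrow> norm (a - q) \<le> norm (a - y)"
    using asymptotic_center_exists[OF b C] unfolding R by blast
  have "norm (y - q) \<le> norm (y - a)" if "y \<in> C" for y
  proof -
    have "inner (a - q) (y - q) \<le> 0"
      using any_closest_point_dot[OF C(2,1) q(1) that, of a] q(2) by (auto simp: dist_norm)
    then have "(norm (y - q))\<^sup>2 \<le> (norm (y - a))\<^sup>2 - (norm (a - q))\<^sup>2"
      unfolding power2_norm_eq_inner by (simp add: inner_simps inner_commute)
    then have "(norm (y - q))\<^sup>2 \<le> (norm (y - a))\<^sup>2"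
      by (smt (verit) zero_le_power2)
    then show ?thesis by (rule power2_le_imp_le) simp
  qed
  then show thesis using q(1) that by blast
qed

text \<open>
  Projecting the center onto \<open>C\<close> brings it no farther from any term of the sequence, so by
  uniqueness the projection is the center itself.
\<close>
lemma asymptotic_center_in_closed_convex:
  fixes x :: "nat \<Rightarrow> 'a::{real_inner, complete_space}"
  assumes b: "bounded (range x)" and C: "closed C" "convex C" and x: "\<And>n. x n \<in> C"
    and min: "\<And>y. asymptotic_radius x c \<le> asymptotic_radius x y"
  shows "c \<in> C"
proof -
  have "C \<noteq> {}" using x by blast
  then obtain q where q: "q \<in> C" "\<And>y. y \<in> C \<Longrightarrow> norm (y - q) \<le> norm (y - c)"
    using closed_convex_projection[OF C] by blast
  have "asymptotic_radius x q \<le> asymptotic_radius x c"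
  proof (rule field_le_epsilon)
    fix e :: real assume "e > 0"
    then have "\<forall>\<^sub>F n in sequentially. norm (x n - c) \<le> asymptotic_radius x c + e"
      by (intro asymptotic_radius_less_imp[OF b]) simp
    then have "\<forall>\<^sub>F n in sequentially. norm (x n - q) \<le> asymptotic_radius x c + e"
      by eventually_elim (rule order_trans[OF q(2)[OF x]])
    then show "asymptotic_radius x q \<le> asymptotic_radius x c + e"
      by (rule asymptotic_radius_le)
  qed
  then have "q = c"
    by (rule asymptotic_center_unique[OF b min])
  then show ?thesis using q(1) by simp
qed

text \<open>
  The substitute for the demiclosedness principle. Up to a vanishing error,
  \<open>\<parallel>x\<^sub>n - T c\<parallel> \<le> \<parallel>T x\<^sub>n - T c\<parallel> \<le> \<parallel>x\<^sub>n - c\<parallel>\<close>, so \<open>T c\<close> is another minimizer.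
\<close>
lemma asymptotic_center_fixed_point:
  fixes x :: "nat \<Rightarrow> 'a::{real_inner, complete_space}"
  assumes b: "bounded (range x)" and M: "closed M" "convex M" and x: "\<And>n. x n \<in> M"
    and T: "nonexpansive_on M T" and reg: "(\<lambda>n. x n - T (x n)) \<longlonglongrightarrow> 0"
    and min: "\<And>y. asymptotic_radius x c \<le> asymptotic_radius x y"
  shows "c \<in> Fix_on M T"
proof -
  have c: "c \<in> M"
    by (rule asymptotic_center_in_closed_convex[OF b M x min])
  have "asymptotic_radius x (T c) \<le> asymptotic_radius x c"
  proof (rule field_le_epsilon)
    fix e :: real assume "e > 0"
    then have "\<forall>\<^sub>F n in sequentially. norm (x n - c) \<le> asymptotic_radius x c + e / 2"
      by (intro asymptotic_radius_less_imp[OF b]) simp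
    moreover have "\<forall>\<^sub>F n in sequentially. norm (x n - T (x n)) < e / 2"
      using order_tendstoD(2)[OF tendsto_norm_zero[OF reg], of "e / 2"] \<open>e > 0\<close> by simp
    ultimately have "\<forall>\<^sub>F n in sequentially. norm (x n - T c) \<le> asymptotic_radius x c + e"
    proof eventually_elim
      case (elim n)
      have "norm (x n - T c) \<le> norm (x n - T (x n)) + norm (T (x n) - T c)"
        using norm_triangle_ineq[of "x n - T (x n)" "T (x n) - T c"] by simp
      also have "norm (T (x n) - T c) \<le> norm (x n - c)"
        using T x c by (auto simp: nonexpansive_on_def)
      finally show ?case using elim by simp
    qed
    then show "asymptotic_radius x (T c) \<le> asymptotic_radius x c + e"
      by (rule asymptotic_radius_le)
  qed
  then have "T c = c"
    by (rule asymptotic_center_unique[OF b min])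
  with c show ?thesis by (simp add: Fix_on_def)
qed

section \<open>Weak convergence from asymptotic centers\<close>

lemma inner_frequently_away_subseq:
  fixes x :: "nat \<Rightarrow> 'a::real_inner"
  assumes "\<not> weakly_converges_to x c"
  obtains v e r where "e > 0" "strict_mono (r :: nat \<Rightarrow> nat)" "\<And>n. (x (r n) - c) \<bullet> v \<ge> e"
proof -
  obtain u where "\<not> (\<lambda>n. x n \<bullet> u) \<longlonglongrightarrow> c \<bullet> u"
    using assms by (auto simp: weakly_converges_to_def)
  then obtain e where e: "e > 0" "\<not> (\<forall>\<^sub>F n in sequentially. dist (x n \<bullet> u) (c \<bullet> u) < e)"
    by (auto simp: tendsto_iff)
  then have "\<exists>\<^sub>F n in sequentially. (x n - c) \<bullet> u \<ge> e \<or> (x n - c) \<bullet> (- u) \<ge> e"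
    unfolding frequently_def
    by (auto simp: dist_real_def inner_simps elim!: contrapos_nn eventually_mono)
  then consider "\<exists>\<^sub>F n in sequentially. (x n - c) \<bullet> u \<ge> e"
    | "\<exists>\<^sub>F n in sequentially. (x n - c) \<bullet> (- u) \<ge> e"
    by (auto simp: frequently_disj_iff)
  then obtain v where v: "\<exists>\<^sub>F n in sequentially. (x n - c) \<bullet> v \<ge> e"
    by cases blast+
  then have inf: "infinite {n. (x n - c) \<bullet> v \<ge> e}"
    by (simp add: frequently_cofinite[symmetric] cofinite_eq_sequentially)
  then obtain r :: "nat \<Rightarrow> nat" where "strict_mono r" "\<And>n. r n \<in> {n. (x n - c) \<bullet> v \<ge> e}"
    using infinite_enumerate by blast
  then show thesis using e(1) that by blast
qed

lemma norm_power2_diff_scaleR: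
  fixes w v :: "'a::real_inner"
  shows "(norm (w - t *\<^sub>R v))\<^sup>2 = (norm w)\<^sup>2 - 2 * t * (w \<bullet> v) + t\<^sup>2 * (norm v)\<^sup>2"
  unfolding power2_norm_eq_inner
  by (simp add: inner_diff inner_commute[of v w] power2_eq_square algebra_simps)

text \<open>
  A variant of Opial's lemma. Asking that the centers of all subsequences lie in \<open>F\<close> replaces the
  usual condition on weak cluster points, whose existence would require weak compactness.
\<close>
lemma weakly_converges_to_asymptotic_center:
  fixes x :: "nat \<Rightarrow> 'a::{real_inner, complete_space}"
  assumes b: "bounded (range x)"
    and lim: "\<And>p. p \<in> F \<Longrightarrow> convergent (\<lambda>n. norm (x n - p))"
    and center: "\<And>r c. strict_mono r \<Longrightarrow>
      (\<And>y. asymptotic_radius (x \<circ> r) c \<le> asymptotic_radius (x \<circ> r) y) \<Longrightarrow> c \<in> F"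
  shows "\<exists>p\<in>F. weakly_converges_to x p"
proof -
  have b': "bounded (range (x \<circ> r))" for r :: "nat \<Rightarrow> nat"
    using b by (rule bounded_subset) auto
  have center_ex: "\<exists>c\<in>F. \<forall>y. asymptotic_radius (x \<circ> r) c \<le> asymptotic_radius (x \<circ> r) y"
    if "strict_mono r" for r
    using asymptotic_center_exists[OF b'[of r], of UNIV] center[OF that]
    by (metis UNIV_I UNIV_not_empty closed_UNIV convex_UNIV)
  have radius: "(\<lambda>n. norm (x (r n) - p)) \<longlonglongrightarrow> asymptotic_radius x p"
      "asymptotic_radius (x \<circ> r) p = asymptotic_radius x p"
    if p: "p \<in> F" and r: "strict_mono r" for p r
  proof -
    obtain l where l: "(\<lambda>n. norm (x n - p)) \<longlonglongrightarrow> l"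
      using lim[OF p] by (auto simp: convergent_def)
    have l': "(\<lambda>n. norm (x (r n) - p)) \<longlonglongrightarrow> l"
      using LIMSEQ_subseq_LIMSEQ[OF l r] by (simp add: o_def)
    show "(\<lambda>n. norm (x (r n) - p)) \<longlonglongrightarrow> asymptotic_radius x p"
      using l' asymptotic_radius_eq_lim[OF l b] by simp
    show "asymptotic_radius (x \<circ> r) p = asymptotic_radius x p"
      using asymptotic_radius_eq_lim[of "x \<circ> r", OF _ b'] l' asymptotic_radius_eq_lim[OF l b]
      by simp
  qed
  obtain c where c: "c \<in> F" "\<And>y. asymptotic_radius x c \<le> asymptotic_radius x y"
    using center_ex[of id] by (auto simp: strict_mono_id)
  have "weakly_converges_to x c"
  proof (rule ccontr)
    assume "\<not> weakly_converges_to x c"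
    then obtain v e r where e: "e > 0" and r: "strict_mono (r :: nat \<Rightarrow> nat)"
      and v: "\<And>n. (x (r n) - c) \<bullet> v \<ge> e"
      by (rule inner_frequently_away_subseq) blast
    obtain c' where c': "c' \<in> F" "\<And>y. asymptotic_radius (x \<circ> r) c' \<le> asymptotic_radius (x \<circ> r) y"
      using center_ex[OF r] by blast
    \<comment> \<open>\<open>c\<close> also minimizes the radius of the subsequence: its center \<open>c'\<close> lies in \<open>F\<close>, where both
      radii agree, and \<open>c\<close> is optimal for the whole sequence.\<close>
    have c_min: "asymptotic_radius x c \<le> asymptotic_radius (x \<circ> r) y" for y
    proof -
      have "asymptotic_radius x c \<le> asymptotic_radius x c'" by (rule c(2))
      also have "\<dots> \<le> asymptotic_radius (x \<circ> r) y"
        using c'(2) radius(2)[OF c'(1) r] by simp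
      finally show ?thesis .
    qed
    let ?s = "asymptotic_radius x c"
    have "v \<noteq> 0" using v[of 0] e by auto
    \<comment> \<open>The squared distance to \<open>c + t v\<close> is at most the one to \<open>c\<close> plus \<open>t\<^sup>2 \<parallel>v\<parallel>\<^sup>2 - 2 t e\<close>; the
      best choice \<open>t = e / \<parallel>v\<parallel>\<^sup>2\<close> gains \<open>k\<close>.\<close>
    define k where "k = e\<^sup>2 / (norm v)\<^sup>2"
    have "k > 0" using e \<open>v \<noteq> 0\<close> by (simp add: k_def)
    define y where "y = c + (e / (norm v)\<^sup>2) *\<^sub>R v"
    have y: "(norm (x (r n) - y))\<^sup>2 \<le> (norm (x (r n) - c))\<^sup>2 - k" for n
    proof -
      let ?t = "e / (norm v)\<^sup>2"
      have "(norm (x (r n) - y))\<^sup>2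
          = (norm (x (r n) - c))\<^sup>2 - 2 * ?t * ((x (r n) - c) \<bullet> v) + ?t\<^sup>2 * (norm v)\<^sup>2"
      proof -
        have "x (r n) - y = (x (r n) - c) - ?t *\<^sub>R v" by (simp add: y_def)
        then show ?thesis by (simp only: norm_power2_diff_scaleR)
      qed
      moreover have "2 * ?t * ((x (r n) - c) \<bullet> v) \<ge> 2 * ?t * e"
        using v e by (intro mult_left_mono) auto
      moreover have "?t\<^sup>2 * (norm v)\<^sup>2 = k" "?t * e = k"
        using \<open>v \<noteq> 0\<close> by (auto simp: k_def power2_eq_square)
      ultimately show ?thesis by linarith
    qed
    have "(\<lambda>n. (norm (x (r n) - c))\<^sup>2) \<longlonglongrightarrow> ?s\<^sup>2"
      by (intro tendsto_intros radius(1)[OF c(1) r])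
    from order_tendstoD(2)[OF this, of "?s\<^sup>2 + k / 2"]
    have "\<forall>\<^sub>F n in sequentially. (norm (x (r n) - c))\<^sup>2 < ?s\<^sup>2 + k / 2"
      using \<open>k > 0\<close> by simp
    then have "\<forall>\<^sub>F n in sequentially. (norm ((x \<circ> r) n - y))\<^sup>2 \<le> ?s\<^sup>2 - k / 2"
    proof eventually_elim
      case (elim n)
      then show ?case using y[of n] unfolding o_def by linarith
    qed
    then have "(asymptotic_radius (x \<circ> r) y)\<^sup>2 \<le> ?s\<^sup>2 - k / 2"
      by (rule asymptotic_radius_power2_le[OF b'])
    moreover have "?s\<^sup>2 \<le> (asymptotic_radius (x \<circ> r) y)\<^sup>2"
      using c_min asymptotic_radius_nonneg[OF b] by (intro power_mono) auto
    ultimately show False using \<open>k > 0\<close> by simp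
  qed
  then show ?thesis using c(1) by blast
qed

section \<open>Real sequences with an inertial recursion\<close>

lemma contractive_recursion_tendsto_zero:
  fixes u e :: "nat \<Rightarrow> real"
  assumes a: "0 \<le> a" "a < 1" and rec: "\<And>n. \<bar>u (Suc n)\<bar> \<le> a * \<bar>u n\<bar> + e n"
    and e: "e \<longlonglongrightarrow> 0"
  shows "u \<longlonglongrightarrow> 0"
proof (rule tendsto_rabs_zero_cancel, rule order_tendstoI)
  show "\<forall>\<^sub>F n in sequentially. t < \<bar>u n\<bar>" if "t < 0" for t
    using that by (intro always_eventually allI) (rule less_le_trans[OF _ abs_ge_zero])
  fix t :: real assume "0 < t"
  then have "\<forall>\<^sub>F n in sequentially. e n < (1 - a) * (t / 2)"
    using a by (intro order_tendstoD(2)[OF e]) auto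
  then obtain N where N: "\<And>n. n \<ge> N \<Longrightarrow> e n < (1 - a) * (t / 2)"
    by (auto simp: eventually_sequentially)
  have bound: "\<bar>u (k + N)\<bar> \<le> a ^ k * \<bar>u N\<bar> + t / 2" for k
  proof (induction k)
    case 0
    then show ?case using \<open>0 < t\<close> by simp
  next
    case (Suc k)
    have "\<bar>u (Suc (k + N))\<bar> \<le> a * \<bar>u (k + N)\<bar> + e (k + N)" by (rule rec)
    also have "\<dots> \<le> a * (a ^ k * \<bar>u N\<bar> + t / 2) + (1 - a) * (t / 2)"
      using Suc a N[of "k + N"] by (intro add_mono mult_left_mono) auto
    also have "\<dots> = a ^ Suc k * \<bar>u N\<bar> + t / 2" by (simp add: field_simps)
    finally show ?case by simp
  qed
  have lim: "(\<lambda>k. a ^ k * \<bar>u N\<bar> + t / 2) \<longlonglongrightarrow> 0 * \<bar>u N\<bar> + t / 2"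
    using a by (intro tendsto_intros LIMSEQ_power_zero) auto
  have "\<forall>\<^sub>F k in sequentially. a ^ k * \<bar>u N\<bar> + t / 2 < t"
    using \<open>0 < t\<close> by (intro order_tendstoD(2)[OF lim]) simp
  then have "\<forall>\<^sub>F k in sequentially. \<bar>u (k + N)\<bar> < t"
    by eventually_elim (rule le_less_trans[OF bound])
  then show "\<forall>\<^sub>F n in sequentially. \<bar>u n\<bar> < t"
    by (subst (asm) eventually_sequentially_seg)
qed

text \<open>
  Replacing \<open>a n\<close> by its limit \<open>q < 1\<close> changes \<open>f (Suc n) - a n * f n\<close> by a null sequence. If
  \<open>L\<close> is the limit, then \<open>f - L / (1 - q)\<close> satisfies a contractive recursion with vanishing
  perturbation.
\<close>
lemma convergent_of_inertial_difference:
  fixes f a :: "nat \<Rightarrow> real"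
  assumes a: "mono a" "\<And>n. 0 \<le> a n" "\<And>n. a n \<le> \<alpha>" "\<alpha> < 1"
    and bnd: "\<And>n. \<bar>f n\<bar> \<le> B"
    and conv: "convergent (\<lambda>n. f (Suc n) - a n * f n)"
  shows "convergent f"
proof -
  obtain L where L: "(\<lambda>n. f (Suc n) - a n * f n) \<longlonglongrightarrow> L"
    using conv by (auto simp: convergent_def)
  obtain q where q: "a \<longlonglongrightarrow> q"
    using incseq_convergent[of a \<alpha>] a by blast
  have q01: "0 \<le> q" "q < 1"
    using LIMSEQ_le_const[OF q, of 0] LIMSEQ_le_const2[OF q, of \<alpha>] a by auto
  have z: "(\<lambda>n. (a n - q) * f n) \<longlonglongrightarrow> 0"
  proof (rule Lim_null_comparison)
    show "\<forall>\<^sub>F n in sequentially. norm ((a n - q) * f n) \<le> \<bar>a n - q\<bar> * B"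
      using bnd by (intro always_eventually allI) (simp add: abs_mult mult_left_mono)
    have "(\<lambda>n. \<bar>a n - q\<bar> * B) \<longlonglongrightarrow> \<bar>q - q\<bar> * B" by (intro tendsto_intros q)
    then show "(\<lambda>n. \<bar>a n - q\<bar> * B) \<longlonglongrightarrow> 0" by simp
  qed
  define l where "l = L / (1 - q)"
  have l: "L = l - q * l" 
  proof -
    have "L = (1 - q) * l" using q01 by (simp add: l_def)
    then show ?thesis by (simp add: algebra_simps)
  qed
  have "(\<lambda>n. f (Suc n) - a n * f n + (a n - q) * f n - L) \<longlonglongrightarrow> L + 0 - L"
    by (intro tendsto_intros L z)
  then have e: "(\<lambda>n. \<bar>f (Suc n) - q * f n - L\<bar>) \<longlonglongrightarrow> 0"
    by (intro tendsto_rabs_zero) (simp add: algebra_simps)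
  have "(\<lambda>n. f n - l) \<longlonglongrightarrow> 0"
  proof (rule contractive_recursion_tendsto_zero[OF q01 _ e])
    fix n
    have "f (Suc n) - l = q * (f n - l) + (f (Suc n) - q * f n - L)"
      by (simp add: l algebra_simps)
    then have "\<bar>f (Suc n) - l\<bar> \<le> \<bar>q * (f n - l)\<bar> + \<bar>f (Suc n) - q * f n - L\<bar>"
      by (metis abs_triangle_ineq)
    then show "\<bar>f (Suc n) - l\<bar> \<le> q * \<bar>f n - l\<bar> + \<bar>f (Suc n) - q * f n - L\<bar>"
      using q01 by (simp add: abs_mult)
  qed
  then show ?thesis
    by (auto simp: convergent_def LIM_zero_iff)
qed

section \<open>Hilbert space identities for one step\<close>

lemma norm_power2_extrapolation:
  fixes u w p :: "'a::real_inner"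
  shows "(norm (u + a *\<^sub>R (u - w) - p))\<^sup>2
    = (1 + a) * (norm (u - p))\<^sup>2 - a * (norm (w - p))\<^sup>2 + a * (1 + a) * (norm (u - w))\<^sup>2"
  unfolding power2_norm_eq_inner
  by (simp add: inner_simps inner_commute algebra_simps)

text \<open>
  The point on the left is the affine combination of \<open>y\<close> and \<open>z\<close> with
  weight \<open>l\<close> on \<open>z\<close>. The subtracted term equals \<open>l (1 - l) \<parallel>z - y\<parallel>\<^sup>2\<close>, written through the step
  \<open>l (z - y)\<close> because the step is what the iterates determine.
\<close>
lemma norm_power2_relaxation:
  fixes y z p :: "'a::real_inner"
  assumes "norm (z - p) \<le> norm (y - p)" "0 < l"
  shows "(norm (y + l *\<^sub>R (z - y) - p))\<^sup>2
    \<le> (norm (y - p))\<^sup>2 - (1 - l) / l * (norm (l *\<^sub>R (z - y)))\<^sup>2"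
proof -
  have "(norm (y + l *\<^sub>R (z - y) - p))\<^sup>2
      = (1 - l) * (norm (y - p))\<^sup>2 + l * (norm (z - p))\<^sup>2 - l * (1 - l) * (norm (z - y))\<^sup>2"
    unfolding power2_norm_eq_inner
    by (simp add: inner_simps inner_commute algebra_simps)
  moreover have "l * (norm (z - p))\<^sup>2 \<le> l * (norm (y - p))\<^sup>2"
    using assms by (intro mult_left_mono power_mono) auto
  moreover have "(1 - l) / l * (norm (l *\<^sub>R (z - y)))\<^sup>2 = l * (1 - l) * (norm (z - y))\<^sup>2"
    using assms(2) by (simp add: power_mult_distrib power2_eq_square)
  ultimately show ?thesis by (simp add: algebra_simps)
qed

text \<open>Young's inequality for the cross term, with weight \<open>s\<close>.\<close>
lemma norm_power2_diff_scaled_ge: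
  fixes d d' :: "'a::real_inner"
  assumes "0 \<le> a" "0 < s"
  shows "(1 - a / s) * (norm d)\<^sup>2 - a * (s - a) * (norm d')\<^sup>2 \<le> (norm (d - a *\<^sub>R d'))\<^sup>2"
proof -
  have "0 \<le> a / s * (norm (d - s *\<^sub>R d'))\<^sup>2"
    using assms by simp
  also have "\<dots> = (norm (d - a *\<^sub>R d'))\<^sup>2
      - ((1 - a / s) * (norm d)\<^sup>2 - a * (s - a) * (norm d')\<^sup>2)"
    using assms(2) unfolding power2_norm_eq_inner
    by (simp add: inner_simps inner_commute field_simps)
  finally show ?thesis by simp
qed

section \<open>The inertial iteration\<close>

text \<open>
  Indices are shifted by one so that parameters start at \<open>0\<close>: here \<open>a n\<close> and \<open>l n\<close> are the
  inertial and relaxation parameters of the step that produces \<open>x (n + 2)\<close>.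
\<close>
locale inertial_iteration =
  fixes M :: "'a::{real_inner, complete_space} set"
    and T :: "'a \<Rightarrow> 'a" and x :: "nat \<Rightarrow> 'a"
    and a l :: "nat \<Rightarrow> real"
    and \<alpha> lam \<sigma> \<delta> :: real
  assumes closed_M: "closed M" and affine_M: "affine M"
    and T_M: "T ` M \<subseteq> M" and nonexp: "nonexpansive_on M T"
    and x0: "x 0 \<in> M" and x1: "x (Suc 0) \<in> M"
    and step: "\<And>n. x (Suc (Suc n)) = x (Suc n) + a n *\<^sub>R (x (Suc n) - x n)
      + l n *\<^sub>R (T (x (Suc n) + a n *\<^sub>R (x (Suc n) - x n)) - (x (Suc n) + a n *\<^sub>R (x (Suc n) - x n)))"
    and mono_a: "mono a" and a_ge: "\<And>n. 0 \<le> a n" and a_le: "\<And>n. a n \<le> \<alpha>" and \<alpha>_less: "\<alpha> < 1"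
    and lam_pos: "lam > 0" and \<sigma>_pos: "\<sigma> > 0" and \<delta>_pos: "\<delta> > 0"
    and l_ge: "\<And>n. lam \<le> l n"
    and l_le: "\<And>n. l n \<le> (\<delta> - \<alpha> * (\<alpha> * (1 + \<alpha>) + \<alpha> * \<delta> + \<sigma>))
      / (\<delta> * (1 + \<alpha> * (1 + \<alpha>) + \<alpha> * \<delta> + \<sigma>))"
begin

definition y :: "nat \<Rightarrow> 'a" where
  "y n = x (Suc n) + a n *\<^sub>R (x (Suc n) - x n)"

lemma step_y: "x (Suc (Suc n)) = y n + l n *\<^sub>R (T (y n) - y n)"
  unfolding y_def by (rule step)

lemma \<alpha>_nonneg: "0 \<le> \<alpha>"
  using a_ge a_le order_trans by blast

lemma l_pos: "0 < l n"
  using lam_pos l_ge less_le_trans by blast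

text \<open>The upper bound on \<open>l n\<close>, cleared of its denominator.\<close>
lemma relaxation_bound:
  "\<alpha> * (\<alpha> * (1 + \<alpha>) + \<alpha> * \<delta> + \<sigma>) + \<delta> * l n * (1 + \<alpha> * (1 + \<alpha>) + \<alpha> * \<delta> + \<sigma>) \<le> \<delta>"
proof -
  have "\<delta> * (1 + \<alpha> * (1 + \<alpha>) + \<alpha> * \<delta> + \<sigma>) > 0"
    using \<alpha>_nonneg \<delta>_pos \<sigma>_pos by (intro mult_pos_pos add_nonneg_pos add_nonneg_nonneg) auto
  then show ?thesis
    using l_le[of n] by (simp add: pos_le_divide_eq algebra_simps)
qed

lemma l_le_1: "l n \<le> 1"
proof -
  let ?g = "\<alpha> * (1 + \<alpha>) + \<alpha> * \<delta> + \<sigma>"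
  have g: "0 \<le> ?g" using \<alpha>_nonneg \<delta>_pos \<sigma>_pos by simp
  have "\<delta> * l n * 1 \<le> \<delta> * l n * (1 + ?g)"
    using g \<delta>_pos l_pos[of n] by (intro mult_left_mono) auto
  also have "\<dots> \<le> \<delta>"
    using relaxation_bound[of n] mult_nonneg_nonneg[OF \<alpha>_nonneg g] by (simp add: add.assoc)
  finally show ?thesis using \<delta>_pos by simp
qed

lemma affine_step:
  assumes "p \<in> M" "q \<in> M"
  shows "q + t *\<^sub>R (q - p) \<in> M"
  using mem_affine[OF affine_M assms(2,1), of "1 + t" "- t"] by (simp add: algebra_simps)

lemma x_in_M: "x n \<in> M" and y_in_M: "y n \<in> M"
proof -
  have "x n \<in> M \<and> x (Suc n) \<in> M" for n
  proof (induction n)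
    case 0
    then show ?case using x0 x1 by simp
  next
    case (Suc n)
    then have y: "y n \<in> M" unfolding y_def by (intro affine_step) auto
    then have "T (y n) \<in> M" using T_M by blast
    then have "x (Suc (Suc n)) \<in> M"
      unfolding step_y using affine_step[OF _ y, of "T (y n)" "- l n"] by (simp add: algebra_simps)
    then show ?case using Suc by simp
  qed
  then show "x n \<in> M" "y n \<in> M" unfolding y_def by (auto intro: affine_step)
qed

text \<open>
  The weight of the squared increment in the step inequality: the first summand comes from the
  extrapolation, the second from Young's inequality.
\<close>
definition \<gamma> :: "nat \<Rightarrow> real" where
  "\<gamma> n = a n * (1 + a n) + a n * (1 - l n) * \<delta>"

lemma \<gamma>_nonneg: "0 \<le> \<gamma> n"
  using a_ge[of n] l_le_1[of n] \<delta>_pos by (simp add: \<gamma>_def)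

lemma \<gamma>_le: "\<gamma> n \<le> \<alpha> * (1 + \<alpha>) + \<alpha> * \<delta>"
proof -
  have "a n * (1 + a n) \<le> \<alpha> * (1 + \<alpha>)"
    using a_ge[of n] a_le[of n] by (intro mult_mono) auto
  moreover have "a n * (1 - l n) \<le> \<alpha> * 1"
    using a_ge[of n] a_le[of n] l_le_1[of n] l_pos[of n] \<alpha>_nonneg by (intro mult_mono) auto
  then have "a n * (1 - l n) * \<delta> \<le> \<alpha> * 1 * \<delta>"
    using \<delta>_pos by (intro mult_right_mono) auto
  ultimately show ?thesis by (simp add: \<gamma>_def)
qed

text \<open>
  Relaxation towards \<open>T (y n)\<close>, extrapolation from \<open>x (Suc n)\<close> to \<open>y n\<close>, and Young's inequality
  are combined. The weight \<open>s = a n + \<delta> * l n\<close> in Young's inequality is chosen so that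
  \<open>1 - a n / s\<close> and \<open>s - a n\<close> are both multiples of \<open>l n\<close>; this cancels the denominator in the
  factor \<open>(1 - l n) / l n\<close>, which could otherwise be large.
\<close>
lemma distance_recursion:
  assumes p: "p \<in> Fix_on M T"
  shows "(norm (x (Suc (Suc n)) - p))\<^sup>2
    \<le> (1 + a n) * (norm (x (Suc n) - p))\<^sup>2 - a n * (norm (x n - p))\<^sup>2
      + \<gamma> n * (norm (x (Suc n) - x n))\<^sup>2
      - (1 - l n) * \<delta> / (a n + \<delta> * l n) * (norm (x (Suc (Suc n)) - x (Suc n)))\<^sup>2"
proof -
  let ?d = "x (Suc n) - x n" and ?d' = "x (Suc (Suc n)) - x (Suc n)" and ?s = "a n + \<delta> * l n"
  have s: "0 < ?s" using a_ge[of n] \<delta>_pos l_pos[of n] by (simp add: add_nonneg_pos)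
  have Tp: "norm (T (y n) - p) \<le> norm (y n - p)"
    using p nonexp y_in_M[of n] unfolding Fix_on_def nonexpansive_on_def by force
  have increment: "l n *\<^sub>R (T (y n) - y n) = ?d' - a n *\<^sub>R ?d"
    using step_y[of n] by (simp add: y_def)
  have 1: "(norm (x (Suc (Suc n)) - p))\<^sup>2
      \<le> (norm (y n - p))\<^sup>2 - (1 - l n) / l n * (norm (?d' - a n *\<^sub>R ?d))\<^sup>2"
    using norm_power2_relaxation[OF Tp l_pos[of n]] unfolding step_y[of n, symmetric] unfolding increment .
  have 2: "(norm (y n - p))\<^sup>2 = (1 + a n) * (norm (x (Suc n) - p))\<^sup>2 - a n * (norm (x n - p))\<^sup>2
      + a n * (1 + a n) * (norm ?d)\<^sup>2"
    unfolding y_def by (rule norm_power2_extrapolation)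
  have "(1 - l n) / l n * ((1 - a n / ?s) * (norm ?d')\<^sup>2 - a n * (?s - a n) * (norm ?d)\<^sup>2)
      \<le> (1 - l n) / l n * (norm (?d' - a n *\<^sub>R ?d))\<^sup>2"
    using l_le_1[of n] l_pos[of n] a_ge[of n] s
    by (intro mult_left_mono norm_power2_diff_scaled_ge) auto
  moreover have "(1 - l n) / l n * ((1 - a n / ?s) * (norm ?d')\<^sup>2 - a n * (?s - a n) * (norm ?d)\<^sup>2)
      = (1 - l n) * \<delta> / ?s * (norm ?d')\<^sup>2 - a n * (1 - l n) * \<delta> * (norm ?d)\<^sup>2"
  proof -
    have "1 - a n / ?s = \<delta> * l n / ?s"
      using s by (simp add: field_simps)
    then have "(1 - a n / ?s) * (norm ?d')\<^sup>2 - a n * (?s - a n) * (norm ?d)\<^sup>2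
        = l n * (\<delta> / ?s * (norm ?d')\<^sup>2 - a n * \<delta> * (norm ?d)\<^sup>2)"
      by (simp add: right_diff_distrib)
    then have "(1 - l n) / l n * ((1 - a n / ?s) * (norm ?d')\<^sup>2 - a n * (?s - a n) * (norm ?d)\<^sup>2)
        = (1 - l n) * (\<delta> / ?s * (norm ?d')\<^sup>2 - a n * \<delta> * (norm ?d)\<^sup>2)"
      using l_pos[of n] by simp
    then show ?thesis
      by (simp add: algebra_simps diff_divide_distrib)
  qed
  ultimately show ?thesis
    using 1 2 by (simp add: \<gamma>_def algebra_simps)
qed

definition energy :: "'a \<Rightarrow> nat \<Rightarrow> real" where
  "energy p n = (norm (x (Suc n) - p))\<^sup>2 - a n * (norm (x n - p))\<^sup>2
    + \<gamma> n * (norm (x (Suc n) - x n))\<^sup>2"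

text \<open>
  Monotonicity of \<open>a\<close> allows replacing \<open>a n\<close> by \<open>a (Suc n)\<close> in the middle distance. What remains
  is that the gain \<open>(1 - l n) \<delta> / (a n + \<delta> l n)\<close> beats the next weight \<open>\<gamma> (Suc n)\<close> by \<open>\<sigma>\<close>, and
  with \<open>a\<close> and \<open>\<gamma>\<close> replaced by their upper bounds this is \<open>relaxation_bound\<close>.
\<close>
lemma energy_decrease:
  assumes p: "p \<in> Fix_on M T"
  shows "energy p (Suc n) + \<sigma> * (norm (x (Suc (Suc n)) - x (Suc n)))\<^sup>2 \<le> energy p n"
proof -
  let ?D = "(norm (x (Suc (Suc n)) - x (Suc n)))\<^sup>2" and ?s = "a n + \<delta> * l n"
  let ?g = "\<alpha> * (1 + \<alpha>) + \<alpha> * \<delta> + \<sigma>"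
  have s: "0 < ?s" using a_ge[of n] \<delta>_pos l_pos[of n] by (simp add: add_nonneg_pos)
  have "(\<gamma> (Suc n) + \<sigma>) * ?s \<le> ?g * (\<alpha> + \<delta> * l n)"
    using \<gamma>_le[of "Suc n"] \<gamma>_nonneg[of "Suc n"] \<sigma>_pos a_le[of n] s by (intro mult_mono) auto
  also have "\<dots> \<le> (1 - l n) * \<delta>"
    using relaxation_bound[of n] by (simp add: algebra_simps)
  finally have "\<gamma> (Suc n) + \<sigma> \<le> (1 - l n) * \<delta> / ?s"
    using s by (simp add: pos_le_divide_eq)
  then have "(\<gamma> (Suc n) + \<sigma>) * ?D \<le> (1 - l n) * \<delta> / ?s * ?D"
    by (intro mult_right_mono) auto
  moreover have "a n * (norm (x (Suc n) - p))\<^sup>2 \<le> a (Suc n) * (norm (x (Suc n) - p))\<^sup>2"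
    using mono_a by (intro mult_right_mono) (auto simp: mono_def)
  ultimately show ?thesis
    using distance_recursion[OF p, of n] unfolding energy_def by (simp add: algebra_simps)
qed

lemma energy_decseq:
  assumes "p \<in> Fix_on M T"
  shows "decseq (energy p)"
proof (rule decseq_SucI)
  fix n
  have "0 \<le> \<sigma> * (norm (x (Suc (Suc n)) - x (Suc n)))\<^sup>2"
    using \<sigma>_pos by simp
  then show "energy p (Suc n) \<le> energy p n"
    using energy_decrease[OF assms, of n] by linarith
qed

lemma energy_lower_bound:
  "(norm (x (Suc n) - p))\<^sup>2 - \<alpha> * (norm (x n - p))\<^sup>2 \<le> energy p n"
proof -
  have "a n * (norm (x n - p))\<^sup>2 \<le> \<alpha> * (norm (x n - p))\<^sup>2"
    using a_le by (intro mult_right_mono) auto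
  moreover have "0 \<le> \<gamma> n * (norm (x (Suc n) - x n))\<^sup>2"
    using \<gamma>_nonneg by simp
  ultimately show ?thesis unfolding energy_def by linarith
qed

text \<open>
  The squared distances satisfy \<open>\<phi> (n + 1) \<le> \<alpha> \<phi> n + energy p 0\<close>, and \<open>energy p 0 / (1 - \<alpha>)\<close> is
  the fixed point of this affine recursion.
\<close>
lemma distance_bound:
  assumes p: "p \<in> Fix_on M T"
  shows "(norm (x n - p))\<^sup>2 \<le> max ((norm (x 0 - p))\<^sup>2) (energy p 0 / (1 - \<alpha>))"
proof (induction n)
  case 0
  then show ?case by simp
next
  case (Suc n)
  let ?B = "max ((norm (x 0 - p))\<^sup>2) (energy p 0 / (1 - \<alpha>))"
  have "energy p 0 / (1 - \<alpha>) \<le> ?B" by simp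
  then have "energy p 0 \<le> (1 - \<alpha>) * ?B"
    using \<alpha>_less by (simp only: pos_divide_le_eq mult.commute diff_gt_0_iff_gt)
  moreover have "energy p n \<le> energy p 0"
    using decseqD[OF energy_decseq[OF p]] by simp
  moreover have "\<alpha> * (norm (x n - p))\<^sup>2 \<le> \<alpha> * ?B"
    using Suc \<alpha>_nonneg by (rule mult_left_mono)
  ultimately have "(norm (x (Suc n) - p))\<^sup>2 \<le> \<alpha> * ?B + (1 - \<alpha>) * ?B"
    using energy_lower_bound[of n p] by linarith
  then show ?case by (simp add: algebra_simps)
qed

lemma energy_bounded_below:
  assumes p: "p \<in> Fix_on M T"
  obtains C where "\<And>n. C \<le> energy p n"
proof (rule that)
  fix n
  let ?B = "max ((norm (x 0 - p))\<^sup>2) (energy p 0 / (1 - \<alpha>))"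
  have "\<alpha> * (norm (x n - p))\<^sup>2 \<le> \<alpha> * ?B"
    using distance_bound[OF p] \<alpha>_nonneg by (rule mult_left_mono)
  then show "- (\<alpha> * ?B) \<le> energy p n"
    using energy_lower_bound[of n p] zero_le_power2[of "norm (x (Suc n) - p)"] by linarith
qed

lemma summable_increments:
  assumes p: "p \<in> Fix_on M T"
  shows "summable (\<lambda>n. (norm (x (Suc n) - x n))\<^sup>2)"
proof -
  let ?f = "\<lambda>n. (norm (x (Suc (Suc n)) - x (Suc n)))\<^sup>2"
  obtain C where C: "\<And>n. C \<le> energy p n"
    using energy_bounded_below[OF p] by blast
  have sum: "energy p n + \<sigma> * (\<Sum>k<n. ?f k) \<le> energy p 0" for n
  proof (induction n)
    case (Suc n)
    then show ?case using energy_decrease[OF p, of n] by (simp add: distrib_left)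
  qed simp
  have "summable ?f"
  proof (rule summableI_nonneg_bounded)
    fix n
    show "(\<Sum>k<n. ?f k) \<le> (energy p 0 - C) / \<sigma>"
      using sum[of n] C[of n] \<sigma>_pos by (simp add: pos_le_divide_eq mult.commute)
  qed simp
  then show ?thesis
    by (subst (asm) summable_Suc_iff)
qed

lemma increments_tendsto_zero:
  assumes "p \<in> Fix_on M T"
  shows "(\<lambda>n. x (Suc n) - x n) \<longlonglongrightarrow> 0"
proof -
  have "(\<lambda>n. sqrt ((norm (x (Suc n) - x n))\<^sup>2)) \<longlonglongrightarrow> sqrt 0"
    by (intro tendsto_real_sqrt summable_LIMSEQ_zero summable_increments[OF assms])
  then show ?thesis by (simp add: tendsto_norm_zero_iff)
qed

lemma bounded_iterates:
  assumes p: "p \<in> Fix_on M T"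
  shows "bounded (range x)"
proof -
  let ?B = "max ((norm (x 0 - p))\<^sup>2) (energy p 0 / (1 - \<alpha>))"
  have "norm (x n) \<le> norm p + sqrt ?B" for n
    using real_le_rsqrt[OF distance_bound[OF p, of n]] norm_triangle_ineq[of p "x n - p"] by simp
  then show ?thesis by (auto simp: bounded_iff)
qed

lemma convergent_distance:
  assumes p: "p \<in> Fix_on M T"
  shows "convergent (\<lambda>n. norm (x n - p))"
proof -
  let ?f = "\<lambda>n. (norm (x n - p))\<^sup>2"
  obtain C where "\<And>n. C \<le> energy p n"
    using energy_bounded_below[OF p] by blast
  then obtain E where E: "energy p \<longlonglongrightarrow> E"
    using decseq_convergent[OF energy_decseq[OF p]] by blast
  have "(\<lambda>n. \<gamma> n * (norm (x (Suc n) - x n))\<^sup>2) \<longlonglongrightarrow> 0"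
  proof (rule Lim_null_comparison)
    let ?K = "\<alpha> * (1 + \<alpha>) + \<alpha> * \<delta>"
    show "\<forall>\<^sub>F n in sequentially. norm (\<gamma> n * (norm (x (Suc n) - x n))\<^sup>2)
        \<le> ?K * (norm (x (Suc n) - x n))\<^sup>2"
      using \<gamma>_nonneg \<gamma>_le by (intro always_eventually allI) (simp add: mult_right_mono)
    show "(\<lambda>n. ?K * (norm (x (Suc n) - x n))\<^sup>2) \<longlonglongrightarrow> 0"
      by (intro tendsto_mult_right_zero summable_LIMSEQ_zero summable_increments[OF p])
  qed
  from tendsto_diff[OF E this] have "(\<lambda>n. ?f (Suc n) - a n * ?f n) \<longlonglongrightarrow> E"
    by (simp add: energy_def)
  then have "convergent (\<lambda>n. ?f (Suc n) - a n * ?f n)"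
    by (auto simp: convergent_def)
  then have "convergent ?f"
    using convergent_of_inertial_difference[OF mono_a a_ge a_le \<alpha>_less, of ?f]
      distance_bound[OF p] by (metis abs_of_nonneg zero_le_power2)
  then obtain L where "?f \<longlonglongrightarrow> L" by (auto simp: convergent_def)
  then have "(\<lambda>n. sqrt (?f n)) \<longlonglongrightarrow> sqrt L" by (rule tendsto_real_sqrt)
  then show ?thesis by (auto simp: convergent_def)
qed

text \<open>
  The residual at \<open>y n\<close> is \<open>1 / l n \<le> 1 / lam\<close> times the step from \<open>y n\<close> to the next iterate,
  hence small with the increments; nonexpansiveness transfers this to \<open>x (Suc n)\<close>, which is
  within one increment of \<open>y n\<close>.
\<close>
lemma asymptotically_regular:
  assumes p: "p \<in> Fix_on M T"
  shows "(\<lambda>n. x n - T (x n)) \<longlonglongrightarrow> 0"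
proof -
  let ?d = "\<lambda>n. norm (x (Suc n) - x n)"
  have d: "?d \<longlonglongrightarrow> 0"
    by (rule tendsto_norm_zero[OF increments_tendsto_zero[OF p]])
  have "norm (x (Suc n) - T (x (Suc n))) \<le> 2 * ?d n + (?d (Suc n) + ?d n) / lam" for n
  proof -
    have a1: "a n \<le> 1" using a_le[of n] \<alpha>_less by simp
    have yx: "norm (y n - x (Suc n)) \<le> ?d n"
      using a1 a_ge[of n] by (simp add: y_def mult_left_le_one_le)
    have "lam * norm (T (y n) - y n) \<le> l n * norm (T (y n) - y n)"
      using l_ge by (intro mult_right_mono) auto
    also have "\<dots> = norm (x (Suc (Suc n)) - y n)"
      using l_pos[of n] by (simp add: step_y)
    also have "\<dots> \<le> ?d (Suc n) + norm (y n - x (Suc n))"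
      using norm_triangle_ineq4[of "x (Suc (Suc n)) - x (Suc n)" "y n - x (Suc n)"] by simp
    also have "\<dots> \<le> ?d (Suc n) + ?d n" using yx by simp
    finally have Ty: "norm (T (y n) - y n) \<le> (?d (Suc n) + ?d n) / lam"
      using lam_pos by (simp add: pos_le_divide_eq mult.commute)
    have "norm (T (y n) - T (x (Suc n))) \<le> norm (y n - x (Suc n))"
      using nonexp x_in_M y_in_M by (auto simp: nonexpansive_on_def)
    moreover have "norm (x (Suc n) - T (x (Suc n)))
        \<le> norm (y n - x (Suc n)) + norm (T (y n) - y n) + norm (T (y n) - T (x (Suc n)))"
      using norm_triangle_ineq[of "x (Suc n) - y n" "y n - T (x (Suc n))"]
        norm_triangle_ineq[of "y n - T (y n)" "T (y n) - T (x (Suc n))"]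
      by (simp add: norm_minus_commute)
    ultimately show ?thesis using yx Ty by linarith
  qed
  moreover have "(\<lambda>n. 2 * ?d n + (?d (Suc n) + ?d n) / lam) \<longlonglongrightarrow> 2 * 0 + (0 + 0) / lam"
    using lam_pos by (intro tendsto_intros d LIMSEQ_Suc[OF d]) auto
  ultimately have "(\<lambda>n. x (Suc n) - T (x (Suc n))) \<longlonglongrightarrow> 0"
    using Lim_null_comparison[of "\<lambda>n. x (Suc n) - T (x (Suc n))"
        "\<lambda>n. 2 * ?d n + (?d (Suc n) + ?d n) / lam" sequentially]
    by (simp add: always_eventually)
  then show ?thesis by (rule LIMSEQ_imp_Suc)
qed

lemma weak_convergence:
  assumes p: "p \<in> Fix_on M T"
  shows "\<exists>q\<in>Fix_on M T. weakly_converges_to x q"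
proof (rule weakly_converges_to_asymptotic_center[OF bounded_iterates[OF p] convergent_distance])
  fix r :: "nat \<Rightarrow> nat" and c
  assume r: "strict_mono r"
    and min: "\<And>y. asymptotic_radius (x \<circ> r) c \<le> asymptotic_radius (x \<circ> r) y"
  show "c \<in> Fix_on M T"
  proof (rule asymptotic_center_fixed_point[OF _ closed_M affine_imp_convex[OF affine_M] _ nonexp _ min])
    show "bounded (range (x \<circ> r))"
      using bounded_iterates[OF p] by (rule bounded_subset) auto
    show "(x \<circ> r) n \<in> M" for n
      using x_in_M by simp
    show "(\<lambda>n. (x \<circ> r) n - T ((x \<circ> r) n)) \<longlonglongrightarrow> 0"
      using LIMSEQ_subseq_LIMSEQ[OF asymptotically_regular[OF p] r] by (simp add: o_def)
  qed
qed

end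

theorem theorem5:
  fixes M :: "'a::{real_inner, complete_space} set"
    and T :: "'a \<Rightarrow> 'a"
    and x :: "nat \<Rightarrow> 'a"
    and \<alpha>s lams :: "nat \<Rightarrow> real"
    and \<alpha> lam \<sigma> \<delta> :: real
  assumes "M \<noteq> {}" and "closed M" and "affine M"
    and "T ` M \<subseteq> M" and "nonexpansive_on M T" and "Fix_on M T \<noteq> {}"
    and "x 0 \<in> M" and "x 1 \<in> M"
    and "\<forall>n\<ge>1. x (n + 1) = x n + \<alpha>s n *\<^sub>R (x n - x (n - 1))
           + lams n *\<^sub>R (T (x n + \<alpha>s n *\<^sub>R (x n - x (n - 1)))
                         - x n - \<alpha>s n *\<^sub>R (x n - x (n - 1)))"
    and "mono_on {1..} \<alpha>s" and "\<alpha>s 1 = 0"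
    and "\<forall>n\<ge>1. 0 \<le> \<alpha>s n \<and> \<alpha>s n \<le> \<alpha>" and "\<alpha> < 1"
    and "lam > 0" and "\<sigma> > 0" and "\<delta> > 0"
    and "\<delta> > (\<alpha>\<^sup>2 * (1 + \<alpha>) + \<alpha> * \<sigma>) / (1 - \<alpha>\<^sup>2)"
    and "\<forall>n\<ge>1. lam \<le> lams n \<and>
           lams n \<le> (\<delta> - \<alpha> * (\<alpha> * (1 + \<alpha>) + \<alpha> * \<delta> + \<sigma>))
                    / (\<delta> * (1 + \<alpha> * (1 + \<alpha>) + \<alpha> * \<delta> + \<sigma>))"
  shows "summable (\<lambda>n. (norm (x (n + 1) - x n))\<^sup>2) \<and>
         (\<exists>p\<in>Fix_on M T. weakly_converges_to x p)"
proof -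
  interpret inertial_iteration M T x "\<lambda>n. \<alpha>s (Suc n)" "\<lambda>n. lams (Suc n)" \<alpha> lam \<sigma> \<delta>
  proof
    show "x (Suc (Suc n)) = x (Suc n) + \<alpha>s (Suc n) *\<^sub>R (x (Suc n) - x n)
        + lams (Suc n) *\<^sub>R (T (x (Suc n) + \<alpha>s (Suc n) *\<^sub>R (x (Suc n) - x n))
          - (x (Suc n) + \<alpha>s (Suc n) *\<^sub>R (x (Suc n) - x n)))" for n
      using assms(9)[rule_format, of "Suc n"] by (simp add: diff_diff_eq)
    show "mono (\<lambda>n. \<alpha>s (Suc n))"
      using assms(10) by (auto simp: mono_on_def mono_def)
  qed (use assms in auto)
  obtain p where p: "p \<in> Fix_on M T"
    using assms(6) by blast
  show ?thesis
    using summable_increments[OF p] weak_convergence[OF p] by simp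
qed

end
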